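(* Let $p$ be a prime with $p\equiv 15$ or $27\pmod{28}$. For all integers $m,n,k\geq 0$ with $p\nmid n$, \[ c_{9,5}\left(2^{3k+3}p^{2m+1}n+\frac{3\cdot 2^{3k+4}p^{2m+2}+1}{7}\right)\equiv 0\pmod 2. \]
   Context: For complex $a,b$ the false theta function is $\Psi(a,b):=\sum_{n=0}^\infty a^{n(n+1)/2}b^{n(n-1)/2}-\sum_{n=-\infty}^{-1}a^{n(n+1)/2}b^{n(n-1)/2}$. For positive integers $r,s$, the integers $c_{r,s}(n)$ ($n\ge 0$) are defined by the power series identity $\sum_{n=0}^\infty c_{r,s}(n)q^n=\dfrac{1}{\Psi(-q^r,q^s)}$ (the denominator is a power series in $q$ with constant term $1$). *)

theory Defs
  imports
    Complex_Main
    "HOL-Computational_Algebra.Computational_Algebra"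
    "HOL-Number_Theory.Cong"
begin

definition theta_term :: "'a::comm_ring_1 \<Rightarrow> 'a \<Rightarrow> int \<Rightarrow> 'a" where
  "theta_term a b n = a ^ nat (n * (n + 1) div 2) * b ^ nat (n * (n - 1) div 2)"

text \<open>
  The second series is the one over the negative integers \<open>-1, -2, -3, \<dots>\<close>. The type is left
  open so that the same expression denotes the false theta function at complex arguments and, with
  the \<open>X\<close>-adic topology that the library puts on formal power series, the power series obtained by
  substituting monomials in \<open>q\<close> for \<open>a\<close> and \<open>b\<close>.
\<close>

definition false_theta :: "'a::{comm_ring_1, topological_space} \<Rightarrow> 'a \<Rightarrow> 'a" where
  "false_theta a b =
     (\<Sum>n. theta_term a b (int n)) - (\<Sum>n. theta_term a b (- int n - 1))"

text \<open>
  The integer sequence given by \<open>\<Sum>n. c_coeff r s n * q ^ n = 1 / \<Psi>(- q ^ r, q ^ s)\<close>;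
  its existence for positive \<open>r\<close> and \<open>s\<close> is lemma \<open>c_coeff_generating_function\<close> below.
\<close>

definition c_coeff :: "nat \<Rightarrow> nat \<Rightarrow> nat \<Rightarrow> int" where
  "c_coeff r s = (THE d. Abs_fps (\<lambda>n. complex_of_int (d n)) =
                         1 / false_theta (- (fps_X ^ r)) (fps_X ^ s))"

lemma fps_sums_of_nth_eq_0:
  fixes f :: "nat \<Rightarrow> 'a::comm_ring_1 fps"
  assumes "\<And>n i. i < n \<Longrightarrow> fps_nth (f n) i = 0"
  shows "f sums Abs_fps (\<lambda>i. \<Sum>n\<le>i. fps_nth (f n) i)"
  unfolding sums_def
proof (rule tendsto_fpsI)
  fix i
  have "fps_nth (\<Sum>n<N. f n) i = (\<Sum>n\<le>i. fps_nth (f n) i)" if "N > i" for N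
    unfolding fps_sum_nth
    by (rule sum.mono_neutral_right) (use that assms in auto)
  then show "\<forall>\<^sub>F N in sequentially.
      fps_nth (\<Sum>n<N. f n) i = fps_nth (Abs_fps (\<lambda>i. \<Sum>n\<le>i. fps_nth (f n) i)) i"
    by (intro eventually_mono[OF eventually_gt_at_top[of i]]) simp
qed

lemma theta_term_fps_nth:
  fixes n :: int
  defines "j \<equiv> nat (n * (n + 1) div 2)" and "l \<equiv> nat (n * (n - 1) div 2)"
  shows "fps_nth (theta_term (- (fps_X ^ r)) (fps_X ^ s) n :: 'a::comm_ring_1 fps) i =
           (if i = r * j + s * l then (- 1) ^ j else 0)"
proof -
  have "theta_term (- (fps_X ^ r)) (fps_X ^ s) n =
      (fps_const ((- 1) ^ j) * fps_X ^ (r * j + s * l) :: 'a fps)"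
    unfolding theta_term_def j_def[symmetric] l_def[symmetric]
    by (subst power_minus)
      (simp add: power_mult power_add mult.assoc flip: fps_const_power fps_const_neg)
  then show ?thesis
    by simp
qed

lemma triangular_ge: "int n \<le> int n * (int n + 1) div 2"
proof -
  have "2 * int n \<le> int n * (int n + 1)"
    by (cases n) (auto simp: algebra_simps)
  then show ?thesis
    by linarith
qed

lemma theta_term_nonneg_fps_nth_eq_0:
  assumes "r > 0" and "i < n"
  shows "fps_nth (theta_term (- (fps_X ^ r)) (fps_X ^ s) (int n) :: 'a::comm_ring_1 fps) i = 0"
proof -
  define j l where "j = nat (int n * (int n + 1) div 2)" and "l = nat (int n * (int n - 1) div 2)"
  have "n \<le> j"
    using triangular_ge[of n] unfolding j_def by linarith
  also have "j \<le> r * j + s * l"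
    using \<open>r > 0\<close> by (simp add: trans_le_add1)
  finally show ?thesis
    using \<open>i < n\<close> by (simp add: theta_term_fps_nth flip: j_def l_def)
qed

lemma theta_term_neg_fps_nth_eq_0:
  assumes "s > 0" and "i < Suc n"
  shows "fps_nth (theta_term (- (fps_X ^ r)) (fps_X ^ s) (- int n - 1) :: 'a::comm_ring_1 fps) i = 0"
proof -
  define j l where "j = nat ((- int n - 1) * (- int n - 1 + 1) div 2)"
    and "l = nat ((- int n - 1) * (- int n - 1 - 1) div 2)"
  have "(- int n - 1) * (- int n - 1 - 1) = int (Suc n) * (int (Suc n) + 1)"
    by (simp add: algebra_simps)
  then have "Suc n \<le> l"
    using triangular_ge[of "Suc n"] unfolding l_def by linarith
  also have "l \<le> r * j + s * l"
    using \<open>s > 0\<close> by (simp add: trans_le_add2)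
  finally show ?thesis
    using \<open>i < Suc n\<close> by (simp only: theta_term_fps_nth flip: j_def l_def) simp
qed

lemma false_theta_fps_nth:
  assumes "r > 0" and "s > 0"
  shows "fps_nth (false_theta (- (fps_X ^ r)) (fps_X ^ s) :: 'a::comm_ring_1 fps) i =
           (\<Sum>n\<le>i. fps_nth (theta_term (- (fps_X ^ r)) (fps_X ^ s) (int n)) i) -
           (\<Sum>n\<le>i. fps_nth (theta_term (- (fps_X ^ r)) (fps_X ^ s) (- int n - 1)) i)"
proof -
  have 1: "(\<lambda>n. theta_term (- (fps_X ^ r)) (fps_X ^ s) (int n) :: 'a fps) sums
      Abs_fps (\<lambda>i. \<Sum>n\<le>i. fps_nth (theta_term (- (fps_X ^ r)) (fps_X ^ s) (int n)) i)"
    by (rule fps_sums_of_nth_eq_0, rule theta_term_nonneg_fps_nth_eq_0[OF \<open>r > 0\<close>])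
  have 2: "(\<lambda>n. theta_term (- (fps_X ^ r)) (fps_X ^ s) (- int n - 1) :: 'a fps) sums
      Abs_fps (\<lambda>i. \<Sum>n\<le>i. fps_nth (theta_term (- (fps_X ^ r)) (fps_X ^ s) (- int n - 1)) i)"
    by (rule fps_sums_of_nth_eq_0, rule theta_term_neg_fps_nth_eq_0[OF \<open>s > 0\<close>]) simp
  show ?thesis
    unfolding false_theta_def sums_unique[OF 1, symmetric] sums_unique[OF 2, symmetric]
    by simp
qed

lemma false_theta_fps_nth_0:
  assumes "r > 0" and "s > 0"
  shows "fps_nth (false_theta (- (fps_X ^ r)) (fps_X ^ s) :: 'a::comm_ring_1 fps) 0 = 1"
  using assms theta_term_neg_fps_nth_eq_0[where i = 0 and n = 0 and r = r and s = s and 'a = 'a]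
  by (simp add: false_theta_fps_nth theta_term_fps_nth[where n = 0])

lemma fps_inverse_nth_Ints:
  fixes f :: "'a::field fps"
  assumes f: "\<And>n. fps_nth f n \<in> \<int>" and f0: "fps_nth f 0 = 1"
  shows "fps_nth (inverse f) n \<in> \<int>"
proof (induction n rule: less_induct)
  case (less n)
  show ?case
  proof (cases "n = 0")
    case True
    then show ?thesis by (simp add: f0)
  next
    case False
    have "f * inverse f = 1"
      using f0 by (simp add: inverse_mult_eq_1')
    then have "(\<Sum>i=0..n. fps_nth f i * fps_nth (inverse f) (n - i)) = 0"
      using False by (metis fps_mult_nth fps_one_nth)
    then have "fps_nth (inverse f) n = - (\<Sum>i=Suc 0..n. fps_nth f i * fps_nth (inverse f) (n - i))"
      by (simp add: sum.atLeast_Suc_atMost f0 eq_neg_iff_add_eq_0)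
    also have "\<dots> \<in> \<int>"
      using less False f by (intro Ints_minus Ints_sum Ints_mult) auto
    finally show ?thesis .
  qed
qed

lemma c_coeff_generating_function:
  assumes "r > 0" and "s > 0"
  shows "Abs_fps (\<lambda>n. complex_of_int (c_coeff r s n)) = 1 / false_theta (- (fps_X ^ r)) (fps_X ^ s)"
proof -
  let ?\<Psi> = "false_theta (- (fps_X ^ r)) (fps_X ^ s) :: complex fps"
  have "fps_nth ?\<Psi> n \<in> \<int>" for n
    unfolding false_theta_fps_nth[OF assms] theta_term_fps_nth
    by (intro Ints_diff Ints_sum) auto
  then have "fps_nth (inverse ?\<Psi>) n \<in> \<int>" for n
    by (intro fps_inverse_nth_Ints) (simp_all add: false_theta_fps_nth_0 assms)
  then have "\<exists>z. fps_nth (inverse ?\<Psi>) n = complex_of_int z" for n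
    by (metis Ints_cases)
  then obtain d where d: "\<And>n. fps_nth (inverse ?\<Psi>) n = complex_of_int (d n)"
    by metis
  have "1 / ?\<Psi> = inverse ?\<Psi>"
    by (simp add: fps_divide_unit false_theta_fps_nth_0 assms)
  then have d: "Abs_fps (\<lambda>n. complex_of_int (d n)) = 1 / ?\<Psi>"
    by (simp add: fps_eq_iff d)
  show ?thesis
    unfolding c_coeff_def
  proof (rule theI[where P = "\<lambda>d. Abs_fps (\<lambda>n. complex_of_int (d n)) = 1 / ?\<Psi>", OF d])
    fix e
    assume "Abs_fps (\<lambda>n. complex_of_int (e n)) = 1 / ?\<Psi>"
    then have "Abs_fps (\<lambda>n. complex_of_int (e n)) = Abs_fps (\<lambda>n. complex_of_int (d n))"
      using d by simp
    then show "e = d"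
      by (simp add: Abs_fps_inject fun_eq_iff)
  qed
qed

lemma c_coeff_argument_integral:
  fixes p k m :: nat
  assumes "[p = 15] (mod 28) \<or> [p = 27] (mod 28)"
  shows "7 dvd 3 * 2 ^ (3 * k + 4) * p ^ (2 * m + 2) + 1"
proof -
  have "[p = 15] (mod 7) \<or> [p = 27] (mod 7)"
    using assms cong_dvd_modulus_nat[of p _ 28 7] by auto
  then have "[p ^ 2 = 15 ^ 2] (mod 7) \<or> [p ^ 2 = 27 ^ 2] (mod 7)"
    using cong_pow by blast
  then have "[p ^ 2 = 1] (mod 7)"
    by (auto simp: cong_def)
  then have "[(p ^ 2) ^ (m + 1) = 1 ^ (m + 1)] (mod 7)"
    by (rule cong_pow)
  moreover have "(p ^ 2) ^ (m + 1) = p ^ (2 * m + 2)"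
    by (simp only: flip: power_mult) simp
  ultimately have p: "[p ^ (2 * m + 2) = 1] (mod 7)"
    by simp
  have "[(8::nat) ^ k = 1 ^ k] (mod 7)"
    by (rule cong_pow) (simp add: cong_def)
  then have "[8 ^ k * 16 = 1 ^ k * (2::nat)] (mod 7)"
    by (rule cong_mult) (simp add: cong_def)
  moreover have "(8::nat) ^ k * 16 = 2 ^ (3 * k + 4)"
    by (simp add: power_add power_mult)
  ultimately have "[2 ^ (3 * k + 4) = (2::nat)] (mod 7)"
    by simp
  with p have "[3 * 2 ^ (3 * k + 4) * p ^ (2 * m + 2) + 1 = 3 * 2 * 1 + 1] (mod 7)"
    by (intro cong_add cong_mult cong_refl)
  moreover have "[3 * 2 * 1 + 1 = 0] (mod (7::nat))"
    by (simp add: cong_def)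
  ultimately show ?thesis
    using cong_trans cong_0_iff by blast
qed

end

theory Submission
  imports Defs "HOL-Library.Z2" "HOL-Number_Theory.Residues"
begin

text \<open>
  Modulo 2 the false theta function \<open>\<Psi>(- q^9, q^5)\<close> is the full theta series
  \<open>\<Sum>x. q^(7 x\<^sup>2 + 2 x)\<close>, and \<open>7 (7 x\<^sup>2 + 2 x) + 1 = (7 x + 1)\<^sup>2\<close>. Over the field with two elements put
  \<open>T\<^sub>a = \<Sum>q^(x\<^sup>2)\<close>, the sum being over \<open>x \<equiv> a\<close> modulo 7, and \<open>D = \<Sum>n. c n * q^(7 n)\<close>, so that
  \<open>T\<^sub>1 D = q\<close>. Let \<open>U\<close> extract the coefficients with even index. It is linear over squares, and it
  satisfies \<open>U T\<^sub>1 = T\<^sub>3\<^sup>2\<close> and \<open>U (T\<^sub>1 T\<^sub>3) = T\<^sub>1 T\<^sub>2\<close>; the latter is the substitution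
  \<open>(x, y) \<mapsto> (x + y, x - y)\<close>. Three applications of \<open>U\<close> to \<open>1 / T\<^sub>1\<close>, with a factor \<open>T\<^sub>1\<close> cancelled each
  time, give \<open>T\<^sub>3\<^sup>2 / T\<^sub>1\<close>, \<open>T\<^sub>3\<^sup>3 / T\<^sub>1\<close> and \<open>T\<^sub>2 T\<^sub>3\<close>. Hence \<open>c ((8 L + 1) / 7)\<close> is even whenever \<open>L\<close> is not a
  sum of two squares, for instance when a prime that is 3 modulo 4 divides \<open>L\<close> to an odd power.
\<close>

section \<open>Sections of power series, and squaring over the field with two elements\<close>

definition fps_section :: "nat \<Rightarrow> nat \<Rightarrow> 'a fps \<Rightarrow> 'a fps" where
  "fps_section d r f = Abs_fps (\<lambda>n. fps_nth f (d * n + r))"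

lemma fps_nth_section [simp]: "fps_nth (fps_section d r f) n = fps_nth f (d * n + r)"
  by (simp add: fps_section_def)

text \<open>Since \<open>h oo fps_X ^ d\<close> lives on multiples of \<open>d\<close>, the
  coefficient of the product at \<open>d * n + r\<close> only involves coefficients of
  \<open>g\<close> at indices \<open>d * j + r\<close>, and what remains is a Cauchy product in
  \<open>j\<close>.\<close>

lemma fps_section_mult_compose_X_power:
  fixes g h :: "'a::comm_ring_1 fps"
  assumes "r < d"
  shows "fps_section d r (g * (h oo fps_X ^ d)) = fps_section d r g * h"
proof (rule fps_ext)
  fix n
  have *: "d dvd (d * n + r - i) \<longleftrightarrow> (\<exists>j\<le>n. i = d * j + r)" if "i \<le> d * n + r" for i
  proof
    assume "d dvd (d * n + r - i)"
    then obtain t where t: "d * n + r - i = d * t" by blast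
    then have eq: "d * n + r = i + d * t" using that by linarith
    have "t \<le> n"
    proof (rule ccontr)
      assume "\<not> t \<le> n"
      then have "d * (n + 1) \<le> d * t" by (intro mult_le_mono2) simp
      then show False using eq assms by simp
    qed
    then have "i = d * (n - t) + r" using eq by (simp add: diff_mult_distrib2)
    then show "\<exists>j\<le>n. i = d * j + r" by (intro exI[of _ "n - t"]) simp
  next
    assume "\<exists>j\<le>n. i = d * j + r"
    then show "d dvd (d * n + r - i)" by (auto simp flip: diff_mult_distrib2)
  qed
  have "fps_nth (g * (h oo fps_X ^ d)) (d * n + r) =
      (\<Sum>i=0..d * n + r. fps_nth g i * (if d dvd (d * n + r - i) then fps_nth h ((d * n + r - i) div d) else 0))"
    by (simp only: fps_mult_nth fps_nth_compose_X_power)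
  also have "\<dots> = (\<Sum>i\<in>(\<lambda>j. d * j + r) ` {0..n}.
      fps_nth g i * (if d dvd (d * n + r - i) then fps_nth h ((d * n + r - i) div d) else 0))"
  proof (rule sum.mono_neutral_right)
    show "(\<lambda>j. d * j + r) ` {0..n} \<subseteq> {0..d * n + r}" by auto
    show "\<forall>i\<in>{0..d * n + r} - (\<lambda>j. d * j + r) ` {0..n}.
        fps_nth g i * (if d dvd (d * n + r - i) then fps_nth h ((d * n + r - i) div d) else 0) = 0"
    proof
      fix i assume "i \<in> {0..d * n + r} - (\<lambda>j. d * j + r) ` {0..n}"
      then have "\<not> d dvd (d * n + r - i)" by (subst *) auto
      then show "fps_nth g i * (if d dvd (d * n + r - i) then fps_nth h ((d * n + r - i) div d) else 0) = 0"
        by simp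
    qed
  qed simp
  also have "\<dots> = (\<Sum>j=0..n. fps_nth g (d * j + r) * fps_nth h (n - j))"
    using assms
    by (subst sum.reindex) (auto simp: inj_on_def intro!: sum.cong simp flip: diff_mult_distrib2)
  also have "\<dots> = fps_nth (fps_section d r g * h) n"
    by (simp add: fps_mult_nth)
  finally show "fps_nth (fps_section d r (g * (h oo fps_X ^ d))) n = fps_nth (fps_section d r g * h) n"
    by simp
qed

lemma bit_add_self: "a + a = (0 :: bit)"
  by (cases a) simp_all

text \<open>The Frobenius map. In the Cauchy square the terms \<open>i\<close> and
  \<open>n - i\<close> are equal and cancel in characteristic 2, so only a middle term
  \<open>i = n div 2\<close> can survive, and there \<open>a * a = a\<close>.\<close>

lemma bit_fps_square: "f\<^sup>2 = (f oo fps_X ^ 2)" for f :: "bit fps"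
proof (rule fps_ext)
  fix n
  let ?g = "\<lambda>i. fps_nth f i * fps_nth f (n - i)"
  have split: "{0..n} = {i. 2 * i < n} \<union> ({i. i \<le> n \<and> n < 2 * i} \<union> {i. 2 * i = n})"
    by auto
  have fin: "finite {i. 2 * i < n}" "finite {i. i \<le> n \<and> n < 2 * i}" "finite {i. 2 * i = n}"
    by (rule finite_subset[of _ "{..n}"]; auto)+
  have disj: "{i. 2 * i < n} \<inter> ({i. i \<le> n \<and> n < 2 * i} \<union> {i. 2 * i = n}) = {}"
    "{i. i \<le> n \<and> n < 2 * i} \<inter> {i. 2 * i = n} = {}"
    by auto
  have swap: "sum ?g {i. i \<le> n \<and> n < 2 * i} = sum ?g {i. 2 * i < n}"
    by (rule sum.reindex_bij_witness[where i = "\<lambda>i. n - i" and j = "\<lambda>i. n - i"])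
      (auto simp: mult.commute simp del: mult_bit_eq_and)
  have "fps_nth (f\<^sup>2) n = sum ?g {0..n}"
    by (simp only: power2_eq_square fps_mult_nth)
  also have "\<dots> = sum ?g {i. 2 * i < n} + (sum ?g {i. i \<le> n \<and> n < 2 * i} + sum ?g {i. 2 * i = n})"
    unfolding split using fin
    by (simp only: sum.union_disjoint[OF fin(1) finite_UnI[OF fin(2,3)] disj(1)]
        sum.union_disjoint[OF fin(2,3) disj(2)])
  also have "\<dots> = sum ?g {i. 2 * i = n}"
    unfolding swap add.assoc[symmetric] bit_add_self by (rule add_0)
  also have "\<dots> = (if 2 dvd n then fps_nth f (n div 2) else 0)"
  proof (cases "even n")
    case True
    then have "{i. 2 * i = n} = {n div 2}" by auto
    moreover have "n - n div 2 = n div 2" using True by auto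
    moreover have "a * a = a" for a :: bit by (cases a) simp_all
    ultimately show ?thesis using True by (simp del: mult_bit_eq_and)
  next
    case False
    then have "{i. 2 * i = n} = {}" by auto
    then show ?thesis using False by (simp del: mult_bit_eq_and)
  qed
  finally show "fps_nth (f\<^sup>2) n = fps_nth (f oo fps_X ^ 2) n"
    by (simp only: fps_nth_compose_X_power)
qed

lemma fps_section_2_mult_square:
  fixes g h :: "bit fps"
  assumes "r < 2"
  shows "fps_section 2 r (g * h\<^sup>2) = fps_section 2 r g * h"
  using fps_section_mult_compose_X_power[OF assms] by (subst bit_fps_square)

section \<open>Theta series of residue classes modulo 7 and their even sections\<close>

definition residue_theta :: "int \<Rightarrow> bit fps" where
  "residue_theta a = Abs_fps (\<lambda>n. of_bool (\<exists>x. [x = a] (mod 7) \<and> x\<^sup>2 = int n))"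

lemma residue_theta_minus: "residue_theta (- a) = residue_theta a"
proof -
  have "(\<exists>x. [x = - a] (mod 7) \<and> x\<^sup>2 = int n) \<longleftrightarrow> (\<exists>x. [x = a] (mod 7) \<and> x\<^sup>2 = int n)" for n
    by (metis cong_minus_minus_iff minus_minus power2_minus)
  then show ?thesis by (simp add: residue_theta_def)
qed

text \<open>Turns existence into counting: for \<open>a\<close> prime to 7 each \<open>n\<close> is
  the square of at most one \<open>x\<close> in the class of \<open>a\<close>, so the indicator in
  \<open>residue_theta a\<close> is the coefficient of the sum of \<open>q^(x^2)\<close> over that
  class.\<close>

lemma square_inj_residue:
  fixes x y a :: int
  assumes "\<not> 7 dvd a" "[x = a] (mod 7)" "[y = a] (mod 7)" "x\<^sup>2 = y\<^sup>2"
  shows "x = y"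
proof (rule ccontr)
  assume "x \<noteq> y"
  then have "x = - y" using assms(4) by (simp add: power2_eq_iff)
  then have "[a = - a] (mod 7)"
    using assms(2,3) by (metis cong_minus_minus_iff cong_sym cong_trans)
  then have "7 dvd 2 * a" by (simp add: cong_iff_dvd_diff)
  then show False using assms(1) by presburger
qed

definition square_pairs :: "int \<Rightarrow> int \<Rightarrow> nat \<Rightarrow> (int \<times> int) set" where
  "square_pairs a b n = {(x, y). [x = a] (mod 7) \<and> [y = b] (mod 7) \<and> x\<^sup>2 + y\<^sup>2 = int n}"

text \<open>A term \<open>i\<close> of the Cauchy product is nonzero exactly when \<open>i\<close>
  and \<open>n - i\<close> are squares from the two classes. Their roots there are unique, so such
  \<open>i\<close> correspond bijectively to pairs.\<close>

lemma residue_theta_mult_nth: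
  assumes "\<not> 7 dvd a" "\<not> 7 dvd b"
  shows "fps_nth (residue_theta a * residue_theta b) n = of_nat (card (square_pairs a b n))"
proof -
  let ?P = "\<lambda>a n. \<exists>x. [x = a] (mod 7) \<and> x\<^sup>2 = int n"
  let ?I = "{i \<in> {0..n}. ?P a i \<and> ?P b (n - i)}"
  have "bij_betw (\<lambda>(x, y). nat (x\<^sup>2)) (square_pairs a b n) ?I"
    unfolding bij_betw_def
  proof
    show "inj_on (\<lambda>(x, y). nat (x\<^sup>2)) (square_pairs a b n)"
    proof (rule inj_onI, clarify)
      fix x y x' y' :: int
      assume "(x, y) \<in> square_pairs a b n" "(x', y') \<in> square_pairs a b n" and eq: "nat (x\<^sup>2) = nat (x'\<^sup>2)"
      then have xy: "[x = a] (mod 7)" "[x' = a] (mod 7)" "[y = b] (mod 7)" "[y' = b] (mod 7)"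
        and sum: "x\<^sup>2 + y\<^sup>2 = int n" "x'\<^sup>2 + y'\<^sup>2 = int n"
        by (simp_all add: square_pairs_def)
      have x2: "x\<^sup>2 = x'\<^sup>2" using eq by (metis int_nat_eq zero_le_power2)
      moreover have "y\<^sup>2 = y'\<^sup>2" using sum x2 by linarith
      ultimately show "x = x' \<and> y = y'"
        using square_inj_residue[OF assms(1) xy(1,2)] square_inj_residue[OF assms(2) xy(3,4)] by blast
    qed
    show "(\<lambda>(x, y). nat (x\<^sup>2)) ` square_pairs a b n = ?I"
    proof (intro equalityI subsetI)
      fix i assume "i \<in> (\<lambda>(x, y). nat (x\<^sup>2)) ` square_pairs a b n"
      then obtain x y where xy: "[x = a] (mod 7)" "[y = b] (mod 7)" "x\<^sup>2 + y\<^sup>2 = int n" "i = nat (x\<^sup>2)"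
        by (auto simp: square_pairs_def)
      have "i \<le> n" using xy(3,4) zero_le_power2[of y] by linarith
      have "x\<^sup>2 = int i" using xy(4) by simp
      moreover from this have "y\<^sup>2 = int (n - i)" using xy(3) \<open>i \<le> n\<close> by (simp add: of_nat_diff)
      ultimately have "?P a i" "?P b (n - i)" using xy(1,2) by blast+
      then show "i \<in> ?I" using \<open>i \<le> n\<close> by simp
    next
      fix i assume "i \<in> ?I"
      then obtain x y where xy: "[x = a] (mod 7)" "[y = b] (mod 7)" "x\<^sup>2 = int i" "y\<^sup>2 = int (n - i)" "i \<le> n"
        by auto
      then have "(x, y) \<in> square_pairs a b n" by (auto simp: square_pairs_def of_nat_diff)
      moreover have "i = (\<lambda>(x, y). nat (x\<^sup>2)) (x, y)" using xy(3) by simp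
      ultimately show "i \<in> (\<lambda>(x, y). nat (x\<^sup>2)) ` square_pairs a b n" by (rule rev_image_eqI)
    qed
  qed
  then have "card (square_pairs a b n) = card ?I" by (rule bij_betw_same_card)
  moreover have "fps_nth (residue_theta a * residue_theta b) n =
      (\<Sum>i\<in>{0..n}. of_bool (?P a i \<and> ?P b (n - i)))"
    by (simp only: residue_theta_def fps_mult_nth fps_nth_Abs_fps of_bool_conj)
  moreover have "\<dots> = of_nat (card ?I)"
    by (subst sum_of_bool_eq) (rule finite_atLeastAtMost, rule arg_cong[of _ _ "\<lambda>A. of_nat (card A)"], blast)
  ultimately show ?thesis by (simp only:)
qed

lemma cong_double_cancel_7: "[2 * x = 2 * y] (mod 7) \<Longrightarrow> [x = y] (mod 7)" for x y :: int
  unfolding cong_iff_dvd_diff by presburger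

text \<open>If \<open>x^2 = 2 * n\<close> then \<open>x = 2 * y\<close> and
  \<open>n = 2 * y^2\<close>. By Frobenius the exponents \<open>2 * y^2\<close> are those of the
  square of the series for the class of \<open>y\<close>, which is \<open>a\<close> halved modulo
  7.\<close>

lemma even_section_residue_theta:
  assumes "[2 * b = a] (mod 7)"
  shows "fps_section 2 0 (residue_theta a) = (residue_theta b)\<^sup>2"
proof (rule fps_ext)
  fix n
  have "(\<exists>x. [x = a] (mod 7) \<and> x\<^sup>2 = int (2 * n)) \<longleftrightarrow>
      even n \<and> (\<exists>y. [y = b] (mod 7) \<and> y\<^sup>2 = int (n div 2))"
  proof
    assume "\<exists>x. [x = a] (mod 7) \<and> x\<^sup>2 = int (2 * n)"
    then obtain x where x: "[x = a] (mod 7)" "x\<^sup>2 = int (2 * n)" by blast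
    then have "even (x\<^sup>2)" by simp
    then obtain y where y: "x = 2 * y" by auto
    then have "int n = 2 * y\<^sup>2" using x(2) by (simp add: power2_eq_square)
    moreover from this have "even n" by presburger
    moreover have "[2 * y = 2 * b] (mod 7)" using x(1) y assms by (simp add: cong_def)
    then have "[y = b] (mod 7)" by (rule cong_double_cancel_7)
    ultimately show "even n \<and> (\<exists>y. [y = b] (mod 7) \<and> y\<^sup>2 = int (n div 2))"
      by (auto simp: zdiv_int intro!: exI[of _ y])
  next
    assume "even n \<and> (\<exists>y. [y = b] (mod 7) \<and> y\<^sup>2 = int (n div 2))"
    then obtain y where y: "even n" "[y = b] (mod 7)" "y\<^sup>2 = int (n div 2)" by blast
    have "(2 * y)\<^sup>2 = int (2 * n)" using y(1,3) by (auto simp: power_mult_distrib zdiv_int)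
    moreover have "[2 * y = a] (mod 7)"
      using cong_trans[OF cong_scalar_left[OF y(2)] assms] .
    ultimately show "\<exists>x. [x = a] (mod 7) \<and> x\<^sup>2 = int (2 * n)" by blast
  qed
  then show "fps_nth (fps_section 2 0 (residue_theta a)) n = fps_nth ((residue_theta b)\<^sup>2) n"
    by (subst bit_fps_square) (simp add: fps_nth_compose_X_power residue_theta_def)
qed

text \<open>The map \<open>(x, y)\<close> to \<open>(x + y, x - y)\<close> doubles
  \<open>x^2 + y^2\<close>. It reaches every pair \<open>(s, t)\<close> with even
  \<open>s^2 + t^2\<close>, as \<open>s\<close> and \<open>t\<close> then have equal parity; adding
  and subtracting the congruences and cancelling 2 recovers the classes.\<close>

lemma even_section_residue_theta_mult:
  assumes "[u + v = a] (mod 7)" "[u - v = b] (mod 7)"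
    and nz: "\<not> 7 dvd a" "\<not> 7 dvd b" "\<not> 7 dvd u" "\<not> 7 dvd v"
  shows "fps_section 2 0 (residue_theta a * residue_theta b) = residue_theta u * residue_theta v"
proof (rule fps_ext)
  fix n
  have sq: "(x + y)\<^sup>2 + (x - y)\<^sup>2 = 2 * (x\<^sup>2 + y\<^sup>2)" for x y :: int
    by (simp add: power2_eq_square algebra_simps)
  have "bij_betw (\<lambda>(x, y). (x + y, x - y)) (square_pairs u v n) (square_pairs a b (2 * n))"
    unfolding bij_betw_def
  proof
    show "inj_on (\<lambda>(x, y). (x + y, x - y)) (square_pairs u v n)"
      by (auto simp: inj_on_def)
    show "(\<lambda>(x, y). (x + y, x - y)) ` square_pairs u v n = square_pairs a b (2 * n)"
    proof (intro equalityI subsetI)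
      fix z assume "z \<in> (\<lambda>(x, y). (x + y, x - y)) ` square_pairs u v n"
      then obtain x y where xy: "[x = u] (mod 7)" "[y = v] (mod 7)" "x\<^sup>2 + y\<^sup>2 = int n" "z = (x + y, x - y)"
        by (auto simp: square_pairs_def)
      have "[x + y = a] (mod 7)" "[x - y = b] (mod 7)"
        using cong_trans[OF cong_add[OF xy(1,2)] assms(1)] cong_trans[OF cong_diff[OF xy(1,2)] assms(2)] .
      then show "z \<in> square_pairs a b (2 * n)"
        using xy(3,4) sq[of x y] by (simp add: square_pairs_def)
    next
      fix z assume "z \<in> square_pairs a b (2 * n)"
      then obtain s t where st: "[s = a] (mod 7)" "[t = b] (mod 7)" "s\<^sup>2 + t\<^sup>2 = int (2 * n)" "z = (s, t)"
        by (auto simp: square_pairs_def)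
      have "even (s\<^sup>2 + t\<^sup>2)" using st(3) by simp
      then have "even (s + t)" by simp
      then obtain x where "s + t = 2 * x" by blast
      then obtain y where xy: "s = x + y" "t = x - y"
        by (metis add_diff_cancel_left' add_diff_eq diff_add_cancel diff_diff_eq2 mult_2)
      have "x\<^sup>2 + y\<^sup>2 = int n" using st(3) sq[of x y] xy by simp
      moreover have "[x + y = u + v] (mod 7)" "[x - y = u - v] (mod 7)"
        using st(1,2) assms(1,2) unfolding xy by (meson cong_sym cong_trans)+
      then have "[x = u] (mod 7)" "[y = v] (mod 7)"
        using cong_add[of "x + y" "u + v" 7 "x - y" "u - v"]
          cong_diff[of "x + y" "u + v" 7 "x - y" "u - v"]
        by (auto intro!: cong_double_cancel_7)
      ultimately have "(x, y) \<in> square_pairs u v n" by (simp add: square_pairs_def)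
      then show "z \<in> (\<lambda>(x, y). (x + y, x - y)) ` square_pairs u v n"
        using st(4) xy by (intro rev_image_eqI[of "(x, y)"]) simp_all
    qed
  qed
  then have "card (square_pairs u v n) = card (square_pairs a b (2 * n))" by (rule bij_betw_same_card)
  then show "fps_nth (fps_section 2 0 (residue_theta a * residue_theta b)) n =
      fps_nth (residue_theta u * residue_theta v) n"
    using nz by (simp add: residue_theta_mult_nth)
qed

section \<open>Three sections of the reciprocal of \<open>residue_theta 1\<close>\<close>

lemma residue_theta_1_neq_0: "residue_theta 1 \<noteq> 0"
proof
  assume "residue_theta 1 = 0"
  then have "fps_nth (residue_theta 1) 1 = 0" by simp
  then have "\<nexists>x::int. [x = 1] (mod 7) \<and> x\<^sup>2 = int 1"
    unfolding residue_theta_def fps_nth_Abs_fps of_bool_eq_0_iff .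
  moreover have "[1 = 1] (mod 7) \<and> (1::int)\<^sup>2 = int 1" by simp
  ultimately show False by blast
qed

text \<open>Here \<open>D\<close> is \<open>q / T\<^sub>1\<close>. The factor \<open>q\<close>
  shifts indices by one, so the first section takes odd indices and the other two even ones,
  matching \<open>8 * L + 1 = 2 * (2 * (2 * L)) + 1\<close>.\<close>

lemma residue_theta_1_reciprocal_nth:
  assumes D: "residue_theta 1 * D = fps_X"
  shows "fps_nth D (8 * L + 1) = fps_nth (residue_theta 2 * residue_theta 3) L"
proof -
  let ?A = "residue_theta 1" and ?B = "residue_theta 2" and ?C = "residue_theta 3"
  have A0: "?A \<noteq> 0" by (rule residue_theta_1_neq_0)
  \<comment> \<open>Twice 3 is -1 modulo 7, and the classes of -1 and 1 have the same
    series.\<close>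
  have UA: "fps_section 2 0 ?A = ?C\<^sup>2"
    using even_section_residue_theta[of 3 "- 1"] by (simp add: residue_theta_minus cong_def)
  have UAC: "fps_section 2 0 (?A * ?C) = ?A * ?B"
    using even_section_residue_theta_mult[of 2 1 3 1] by (simp add: cong_def mult.commute)
  define E where "E = fps_section 2 1 D"
  \<comment> \<open>Squares pass through a section, so the denominator is made a square:
    \<open>D * T\<^sub>1^2 = q * T\<^sub>1\<close>. The section of the left side is then
    \<open>E * T\<^sub>1\<close>.\<close>
  have "D * ?A\<^sup>2 = (?A * D) * ?A"
    by (simp add: power2_eq_square mult_ac)
  then have "D * ?A\<^sup>2 = fps_X * ?A"
    unfolding D .
  then have "E * ?A = fps_section 2 1 (fps_X * ?A)"
    unfolding E_def by (metis fps_section_2_mult_square one_less_numeral_iff semiring_norm(76))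
  also have "\<dots> = fps_section 2 0 ?A"
    by (rule fps_ext) simp
  finally have E: "E * ?A = ?C\<^sup>2" using UA by simp
  define F where "F = fps_section 2 0 E"
  have "E * ?A\<^sup>2 = ?A * ?C\<^sup>2"
    using E by (simp add: power2_eq_square mult_ac)
  then have "F * ?A = fps_section 2 0 ?A * ?C"
    unfolding F_def by (metis fps_section_2_mult_square zero_less_numeral)
  then have F: "F * ?A = ?C ^ 3" using UA by (simp add: power3_eq_cube power2_eq_square)
  have "F * ?A\<^sup>2 = (?A * ?C) * ?C\<^sup>2"
    using F by (simp add: power2_eq_square power3_eq_cube mult_ac)
  then have "fps_section 2 0 F * ?A = fps_section 2 0 (?A * ?C) * ?C"
    by (metis fps_section_2_mult_square zero_less_numeral)
  also have "\<dots> = (?B * ?C) * ?A"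
    using UAC by (simp add: mult_ac)
  finally have "fps_section 2 0 F = ?B * ?C"
    using A0 by simp
  moreover have "fps_nth (fps_section 2 0 F) L = fps_nth D (8 * L + 1)"
    by (simp add: F_def E_def)
  ultimately show ?thesis by simp
qed

lemma false_theta_fps_nth_of_int:
  assumes "r > 0" and "s > 0"
  shows "fps_nth (false_theta (- (fps_X ^ r)) (fps_X ^ s) :: 'a::comm_ring_1 fps) i =
    of_int (fps_nth (false_theta (- (fps_X ^ r)) (fps_X ^ s) :: int fps) i)"
  unfolding false_theta_fps_nth[OF assms] theta_term_fps_nth of_int_diff of_int_sum
  by (intro arg_cong2[of _ _ _ _ "(-)"] sum.cong) auto

lemma c_coeff_mult_false_theta_nth:
  assumes "r > 0" and "s > 0"
  shows "fps_nth (Abs_fps (\<lambda>n. of_int (c_coeff r s n)) *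
      (false_theta (- (fps_X ^ r)) (fps_X ^ s) :: 'a::comm_ring_1 fps)) n =
    of_int (\<Sum>i=0..n. c_coeff r s i * fps_nth (false_theta (- (fps_X ^ r)) (fps_X ^ s)) (n - i))"
  by (simp add: fps_mult_nth false_theta_fps_nth_of_int[OF assms, where 'a = 'a, symmetric])

lemma c_coeff_mult_false_theta:
  assumes "r > 0" and "s > 0"
  shows "Abs_fps (\<lambda>n. of_int (c_coeff r s n)) * false_theta (- (fps_X ^ r)) (fps_X ^ s) =
    (1 :: 'a::comm_ring_1 fps)"
proof -
  let ?\<Psi> = "false_theta (- (fps_X ^ r)) (fps_X ^ s) :: int fps"
  have "Abs_fps (\<lambda>n. of_int (c_coeff r s n)) * false_theta (- (fps_X ^ r)) (fps_X ^ s) =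
      (1 :: complex fps)"
    unfolding c_coeff_generating_function[OF assms]
    by (simp add: fps_divide_unit inverse_mult_eq_1 false_theta_fps_nth_0 assms)
  then have "complex_of_int (\<Sum>i=0..n. c_coeff r s i * fps_nth ?\<Psi> (n - i)) = complex_of_int (of_bool (n = 0))" for n
    unfolding c_coeff_mult_false_theta_nth[OF assms, where 'a = complex, symmetric] by simp
  then have "(\<Sum>i=0..n. c_coeff r s i * fps_nth ?\<Psi> (n - i)) = of_bool (n = 0)" for n
    by (simp only: of_int_eq_iff)
  then show ?thesis
    by (intro fps_ext) (simp only: c_coeff_mult_false_theta_nth[OF assms], simp)
qed

lemma false_theta_9_5_bit:
  "false_theta (- (fps_X ^ 9)) (fps_X ^ 5) =
    Abs_fps (\<lambda>i. of_bool (\<exists>x::int. 7 * x\<^sup>2 + 2 * x = int i) :: bit)"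
proof (rule fps_ext)
  fix i
  have pos: "0 \<le> x * (x + 1)" "0 \<le> x * (x - 1)" for x :: int
    by (cases "x \<ge> 0"; simp add: mult_nonneg_nonneg mult_nonpos_nonpos)
      (cases "x \<ge> 1"; simp add: mult_nonneg_nonneg mult_nonpos_nonpos)
  have expo: "i = 9 * nat (x * (x + 1) div 2) + 5 * nat (x * (x - 1) div 2) \<longleftrightarrow>
      7 * x\<^sup>2 + 2 * x = int i" for x :: int
  proof -
    have "even (x * (x + 1))" "even (x * (x - 1))" by auto
    then obtain j l where jl: "x * (x + 1) = 2 * j" "x * (x - 1) = 2 * l" by (meson evenE)
    then have "0 \<le> j" "0 \<le> l" using pos[of x] by auto
    moreover have "9 * j + 5 * l = 7 * x\<^sup>2 + 2 * x"
      using jl by (simp add: power2_eq_square algebra_simps)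
    ultimately show ?thesis unfolding jl by auto
  qed
  have inj: "x = y" if "7 * x\<^sup>2 + 2 * x = int i" "7 * y\<^sup>2 + 2 * y = int i" for x y :: int
  proof -
    have "(x - y) * (7 * (x + y) + 2) = 0"
      using that by (simp add: power2_eq_square algebra_simps)
    moreover have "7 * (x + y) + 2 \<noteq> 0" by presburger
    ultimately show ?thesis by simp
  qed
  have bnd: "x \<le> int i" "- x - 1 \<le> int i" if "7 * x\<^sup>2 + 2 * x = int i" for x :: int
  proof -
    have "0 \<le> x\<^sup>2" "x \<le> x\<^sup>2" "- x \<le> x\<^sup>2"
      using pos[of x] by (simp_all add: power2_eq_square algebra_simps)
    then show "x \<le> int i" "- x - 1 \<le> int i" using that by auto
  qed
  let ?S = "\<lambda>f. \<Sum>n\<le>i. of_bool (7 * (f n)\<^sup>2 + 2 * f n = int i) :: bit"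
  have nth: "fps_nth (false_theta (- (fps_X ^ 9)) (fps_X ^ 5) :: bit fps) i =
      ?S int + ?S (\<lambda>n. - int n - 1)"
    unfolding false_theta_fps_nth[OF zero_less_numeral zero_less_numeral] theta_term_fps_nth expo minus_bit_def
    by (intro arg_cong2[of _ _ _ _ "(+)"] sum.cong) simp_all
  have S_eq: "?S f = of_bool (\<exists>n\<le>i. 7 * (f n)\<^sup>2 + 2 * f n = int i)" if "inj f" for f
  proof (cases "\<exists>n\<le>i. 7 * (f n)\<^sup>2 + 2 * f n = int i")
    case True
    then obtain m where m: "m \<le> i" "7 * (f m)\<^sup>2 + 2 * f m = int i" by blast
    then have "7 * (f n)\<^sup>2 + 2 * f n = int i \<longleftrightarrow> n = m" for n
      using inj[OF _ m(2)] injD[OF \<open>inj f\<close>, of n m] by metis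
    then show ?thesis using m(1) by (simp add: of_bool_def)
  next
    case False
    then show ?thesis by simp
  qed
  note S_int = S_eq[of int, OF inj_of_nat]
  have S_neg: "?S (\<lambda>n. - int n - 1) = of_bool (\<exists>n\<le>i. 7 * (- int n - 1)\<^sup>2 + 2 * (- int n - 1) = int i)"
    by (rule S_eq) (simp add: inj_def)
  consider (nonneg) m where "7 * (int m)\<^sup>2 + 2 * int m = int i" "m \<le> i"
    | (neg) m where "7 * (- int m - 1)\<^sup>2 + 2 * (- int m - 1) = int i" "m \<le> i"
    | (none) "\<nexists>x::int. 7 * x\<^sup>2 + 2 * x = int i"
  proof (cases "\<exists>x::int. 7 * x\<^sup>2 + 2 * x = int i")
    case True
    then obtain x :: int where x: "7 * x\<^sup>2 + 2 * x = int i" by blast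
    show ?thesis
    proof (cases "x \<ge> 0")
      case True
      then show ?thesis using that(1)[of "nat x"] x bnd(1)[OF x] by simp
    next
      case False
      then have "- int (nat (- x - 1)) - 1 = x" by simp
      then show ?thesis using that(2)[of "nat (- x - 1)"] x bnd(2)[OF x] by simp
    qed
  next
    case False
    then show ?thesis by (rule that(3))
  qed
  then have "?S int + ?S (\<lambda>n. - int n - 1) = of_bool (\<exists>x::int. 7 * x\<^sup>2 + 2 * x = int i)"
  proof cases
    case nonneg
    have "\<not> (\<exists>n\<le>i. 7 * (- int n - 1)\<^sup>2 + 2 * (- int n - 1) = int i)"
    proof clarify
      fix n assume "7 * (- int n - 1)\<^sup>2 + 2 * (- int n - 1) = int i"
      from inj[OF nonneg(1) this] show False by linarith
    qed
    moreover have "\<exists>n\<le>i. 7 * (int n)\<^sup>2 + 2 * int n = int i" "\<exists>x::int. 7 * x\<^sup>2 + 2 * x = int i"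
      using nonneg by blast+
    ultimately show ?thesis unfolding S_int S_neg by simp
  next
    case neg
    have "\<not> (\<exists>n\<le>i. 7 * (int n)\<^sup>2 + 2 * int n = int i)"
    proof clarify
      fix n assume "7 * (int n)\<^sup>2 + 2 * int n = int i"
      from inj[OF neg(1) this] show False by linarith
    qed
    moreover have "\<exists>n\<le>i. 7 * (- int n - 1)\<^sup>2 + 2 * (- int n - 1) = int i"
      "\<exists>x::int. 7 * x\<^sup>2 + 2 * x = int i"
      using neg by blast+
    ultimately show ?thesis unfolding S_int S_neg by simp
  next
    case none
    then have "\<not> (\<exists>n\<le>i. 7 * (int n)\<^sup>2 + 2 * int n = int i)"
      "\<not> (\<exists>n\<le>i. 7 * (- int n - 1)\<^sup>2 + 2 * (- int n - 1) = int i)"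
      by blast+
    with none show ?thesis unfolding S_int S_neg by simp
  qed
  then show "fps_nth (false_theta (- (fps_X ^ 9)) (fps_X ^ 5)) i =
      fps_nth (Abs_fps (\<lambda>i. of_bool (\<exists>x::int. 7 * x\<^sup>2 + 2 * x = int i) :: bit)) i"
    unfolding nth by simp
qed

lemma residue_theta_1_eq:
  "residue_theta 1 = fps_X * (false_theta (- (fps_X ^ 9)) (fps_X ^ 5) oo fps_X ^ 7)"
proof (rule fps_ext)
  fix n
  have "(\<exists>x::int. [x = 1] (mod 7) \<and> x\<^sup>2 = int n) \<longleftrightarrow>
      n \<noteq> 0 \<and> 7 dvd n - 1 \<and> (\<exists>y::int. 7 * y\<^sup>2 + 2 * y = int ((n - 1) div 7))"
  proof
    assume "\<exists>x::int. [x = 1] (mod 7) \<and> x\<^sup>2 = int n"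
    then obtain x :: int where x: "[x = 1] (mod 7)" "x\<^sup>2 = int n" by blast
    then obtain y where y: "x = 7 * y + 1"
      by (auto simp: cong_iff_dvd_diff dvd_def algebra_simps)
    have n: "int n = 7 * (7 * y\<^sup>2 + 2 * y) + 1"
      using x(2) y by (simp add: power2_eq_square algebra_simps)
    have "n \<noteq> 0"
      by (rule notI) (use n in presburger)
    then have m: "int (n - 1) = 7 * (7 * y\<^sup>2 + 2 * y)" using n by (simp add: of_nat_diff)
    then have "int 7 dvd int (n - 1)" by simp
    then have "7 dvd n - 1" by (simp only: int_dvd_int_iff)
    moreover have "7 * y\<^sup>2 + 2 * y = int ((n - 1) div 7)" using m by (simp add: zdiv_int)
    ultimately show "n \<noteq> 0 \<and> 7 dvd n - 1 \<and> (\<exists>y::int. 7 * y\<^sup>2 + 2 * y = int ((n - 1) div 7))"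
      using \<open>n \<noteq> 0\<close> by blast
  next
    assume "n \<noteq> 0 \<and> 7 dvd n - 1 \<and> (\<exists>y::int. 7 * y\<^sup>2 + 2 * y = int ((n - 1) div 7))"
    then obtain y :: int where y: "n \<noteq> 0" "7 dvd n - 1" "7 * y\<^sup>2 + 2 * y = int ((n - 1) div 7)" by blast
    then have "n = 7 * ((n - 1) div 7) + 1" by simp
    then have "int n = 7 * (7 * y\<^sup>2 + 2 * y) + 1" unfolding y(3) by linarith
    then have "(7 * y + 1)\<^sup>2 = int n" by (simp add: power2_eq_square algebra_simps)
    moreover have "[7 * y + 1 = 1] (mod 7)" by (simp add: cong_iff_dvd_diff)
    ultimately show "\<exists>x::int. [x = 1] (mod 7) \<and> x\<^sup>2 = int n" by blast
  qed
  then show "fps_nth (residue_theta 1) n =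
      fps_nth (fps_X * (false_theta (- (fps_X ^ 9)) (fps_X ^ 5) oo fps_X ^ 7)) n"
    by (simp add: residue_theta_def false_theta_9_5_bit fps_nth_compose_X_power)
qed

lemma prime_3_mod_4_dvd_sum_squares:
  fixes x y :: int
  assumes "prime p" "[p = 3] (mod 4)" "int p dvd x\<^sup>2 + y\<^sup>2"
  shows "int p dvd x"
proof (rule ccontr)
  assume nx: "\<not> int p dvd x"
  have p: "prime (int p)" using assms(1) by simp
  have ny: "\<not> int p dvd y"
  proof
    assume "int p dvd y"
    then have "int p dvd x\<^sup>2" using assms(3) by (simp add: power2_eq_square dvd_add_left_iff)
    then show False using p nx by (meson prime_dvd_power)
  qed
  have fermat: "[z ^ (p - 1) = 1] (mod int p)" if "\<not> int p dvd z" for z :: int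
  proof -
    have "\<not> p dvd nat \<bar>z\<bar>" using that by (simp add: dvd_nat_abs_iff)
    then have "[nat \<bar>z\<bar> ^ (p - 1) = 1] (mod p)" using assms(1) by (rule fermat_theorem[rotated])
    then have "[\<bar>z\<bar> ^ (p - 1) = 1] (mod int p)"
      by (simp flip: cong_int_iff)
    moreover have "even (p - 1)" using assms(2) by (simp add: cong_def) presburger
    ultimately show ?thesis by (simp add: power_even_abs)
  qed
  have "p mod 4 = 3" using assms(2) by (simp add: cong_def)
  then obtain t where t: "p = 4 * t + 3" by (metis mult_div_mod_eq)
  have "[x\<^sup>2 = - (y\<^sup>2)] (mod int p)"
    using assms(3) by (simp add: cong_iff_dvd_diff)
  then have "[(x\<^sup>2) ^ (2 * t + 1) = (- (y\<^sup>2)) ^ (2 * t + 1)] (mod int p)" by (rule cong_pow)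
  moreover have "(x\<^sup>2) ^ (2 * t + 1) = x ^ (p - 1)"
    unfolding power_mult[symmetric] t by (rule arg_cong[of _ _ "(^) x"]) simp
  moreover have "(- (y\<^sup>2)) ^ (2 * t + 1) = - ((y\<^sup>2) ^ (2 * t + 1))" by simp
  moreover have "(y\<^sup>2) ^ (2 * t + 1) = y ^ (p - 1)"
    unfolding power_mult[symmetric] t by (rule arg_cong[of _ _ "(^) y"]) simp
  ultimately have "[x ^ (p - 1) = - (y ^ (p - 1))] (mod int p)" by simp
  moreover have "[x ^ (p - 1) = 1] (mod int p)" "[- (y ^ (p - 1)) = - 1] (mod int p)"
    using fermat[OF nx] fermat[OF ny] by (auto simp: cong_minus_minus_iff)
  ultimately have "[1 = - 1] (mod int p)" by (meson cong_sym cong_trans)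
  then have "int p dvd 2" by (simp add: cong_iff_dvd_diff)
  then have "p \<le> 2" by (auto dest: zdvd_imp_le)
  then show False using t by simp
qed

lemma sum_squares_neq_odd_prime_power:
  fixes x y r :: int
  assumes "prime p" "[p = 3] (mod 4)" "\<not> int p dvd r"
  shows "x\<^sup>2 + y\<^sup>2 \<noteq> int p ^ (2 * m + 1) * r"
proof (induction m arbitrary: x y)
  have p0: "int p \<noteq> 0" using assms(1) by auto
  have div: "\<exists>x' y'. x = int p * x' \<and> y = int p * y'" if "int p dvd x\<^sup>2 + y\<^sup>2" for x y
    using prime_3_mod_4_dvd_sum_squares[OF assms(1,2), of x y]
      prime_3_mod_4_dvd_sum_squares[OF assms(1,2), of y x] that
    by (auto simp: add.commute elim!: dvdE)
  {
    case 0
    show ?case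
    proof
      assume eq: "x\<^sup>2 + y\<^sup>2 = int p ^ (2 * 0 + 1) * r"
      then have "int p dvd x\<^sup>2 + y\<^sup>2" by simp
      then obtain x' y' where "x = int p * x'" "y = int p * y'" using div by blast
      then have "int p * (int p * (x'\<^sup>2 + y'\<^sup>2)) = int p * r"
        using eq by (simp add: power2_eq_square algebra_simps)
      then have "r = int p * (x'\<^sup>2 + y'\<^sup>2)" using p0 by simp
      then show False using assms(3) by simp
    qed
  next
    case (Suc m)
    show ?case
    proof
      assume eq: "x\<^sup>2 + y\<^sup>2 = int p ^ (2 * Suc m + 1) * r"
      then have "int p dvd x\<^sup>2 + y\<^sup>2" by simp
      then obtain x' y' where "x = int p * x'" "y = int p * y'" using div by blast
      then have "(int p)\<^sup>2 * (x'\<^sup>2 + y'\<^sup>2) = (int p)\<^sup>2 * (int p ^ (2 * m + 1) * r)"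
        using eq by (simp add: power2_eq_square algebra_simps)
      then have "x'\<^sup>2 + y'\<^sup>2 = int p ^ (2 * m + 1) * r" using p0 by simp
      then show False using Suc by blast
    qed
  }
qed

lemma even_if_bit_of_int_eq_0:
  assumes "(of_int z :: bit) = 0"
  shows "even z"
proof (rule ccontr)
  assume "odd z"
  then obtain w where "z = 2 * w + 1" by (elim oddE)
  then have "(of_int z :: bit) = 2 * of_int w + 1" by (simp only: of_int_add of_int_mult) simp
  then show False using assms by simp
qed

lemma c_coeff_9_5_even:
  assumes "7 * N = 8 * L + 1" and "\<And>x y. x\<^sup>2 + y\<^sup>2 \<noteq> int L"
  shows "even (c_coeff 9 5 N)"
proof -
  let ?\<Psi> = "false_theta (- (fps_X ^ 9)) (fps_X ^ 5) :: bit fps"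
  define c where "c = Abs_fps (\<lambda>n. of_int (c_coeff 9 5 n) :: bit)"
  have X7: "fps_nth (fps_X ^ 7 :: bit fps) 0 = 0" by (simp add: fps_X_power_nth)
  have "(?\<Psi> oo fps_X ^ 7) * (c oo fps_X ^ 7) = (c * ?\<Psi> oo fps_X ^ 7)"
    unfolding fps_compose_mult_distrib[OF X7] by (rule mult.commute)
  also have "\<dots> = 1"
    using c_coeff_mult_false_theta[of 9 5, where 'a = bit] by (simp add: c_def)
  finally have "residue_theta 1 * (c oo fps_X ^ 7) = fps_X"
    by (simp add: residue_theta_1_eq mult.assoc)
  then have "fps_nth (c oo fps_X ^ 7) (8 * L + 1) = fps_nth (residue_theta 2 * residue_theta 3) L"
    by (rule residue_theta_1_reciprocal_nth)
  also have "\<dots> = of_nat (card (square_pairs 2 3 L))"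
    by (rule residue_theta_mult_nth) simp_all
  also have "square_pairs 2 3 L = {}"
    using assms(2) by (auto simp: square_pairs_def)
  finally have "fps_nth (c oo fps_X ^ 7) (7 * N) = 0"
    by (simp add: assms(1))
  then have "(of_int (c_coeff 9 5 N) :: bit) = 0"
    by (simp only: fps_nth_compose_X_power) (simp add: c_def)
  then show ?thesis by (rule even_if_bit_of_int_eq_0)
qed

theorem theorem6p2:
  fixes p m n k :: nat
  assumes "prime p"
    and "[p = 15] (mod 28) \<or> [p = 27] (mod 28)"
    and "\<not> p dvd n"
  shows "[c_coeff 9 5 (2 ^ (3 * k + 3) * p ^ (2 * m + 1) * n +
                 (3 * 2 ^ (3 * k + 4) * p ^ (2 * m + 2) + 1) div 7) = 0] (mod 2)"
proof -
  let ?N = "2 ^ (3 * k + 3) * p ^ (2 * m + 1) * n + (3 * 2 ^ (3 * k + 4) * p ^ (2 * m + 2) + 1) div 7"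
  let ?r = "8 ^ k * (7 * n + 6 * p)"
  have p4: "[p = 3] (mod 4)"
    using assms(2)
  proof
    assume "[p = 15] (mod 28)"
    then have "[p = 15] (mod 4)" by (rule cong_dvd_modulus_nat) simp
    then show ?thesis by (simp add: cong_def)
  next
    assume "[p = 27] (mod 28)"
    then have "[p = 27] (mod 4)" by (rule cong_dvd_modulus_nat) simp
    then show ?thesis by (simp add: cong_def)
  qed
  have p7: "\<not> p dvd 7"
  proof
    assume "p dvd 7"
    moreover have "prime (7::nat)" by simp
    ultimately have "p = 7" using assms(1) by (simp add: primes_dvd_imp_eq)
    then show False using assms(2) by (simp add: cong_def)
  qed
  have p2: "\<not> p dvd 8 ^ k"
  proof
    assume "p dvd 8 ^ k"
    then have "p dvd 2 ^ (3 * k)" by (simp add: power_mult)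
    then have "p dvd 2" by (rule prime_dvd_power[OF assms(1)])
    then have "p \<le> 2" by (rule dvd_imp_le) simp
    then show False using p4 assms(1) prime_ge_2_nat[of p] by (simp add: cong_def)
  qed
  have "\<not> p dvd 7 * n + 6 * p"
    using assms(1,3) p7 by (simp add: prime_dvd_mult_iff dvd_add_left_iff)
  then have "\<not> p dvd ?r"
    using p2 assms(1) prime_dvd_mult_iff by blast
  then have pr: "\<not> int p dvd int ?r"
    unfolding int_dvd_int_iff .
  have two_pows: "(2::nat) ^ (3 * k + 3) = 8 ^ k * 8" "(2::nat) ^ (3 * k + 4) = 8 ^ k * 16"
    by (simp_all add: power_add power_mult)
  have p_pow: "p ^ (2 * m + 2) = p ^ (2 * m + 1) * p"
    by simp
  have "7 * ?N = 7 * (2 ^ (3 * k + 3) * p ^ (2 * m + 1) * n) + (3 * 2 ^ (3 * k + 4) * p ^ (2 * m + 2) + 1)"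
    using c_coeff_argument_integral[OF assms(2), of k m] by (simp only: distrib_left dvd_mult_div_cancel)
  also have "\<dots> = 8 * (p ^ (2 * m + 1) * ?r) + 1"
    unfolding two_pows p_pow by (simp add: distrib_left mult_ac)
  finally have "even (c_coeff 9 5 ?N)"
  proof (rule c_coeff_9_5_even)
    show "x\<^sup>2 + y\<^sup>2 \<noteq> int (p ^ (2 * m + 1) * ?r)" for x y
      using sum_squares_neq_odd_prime_power[OF assms(1) p4 pr, of x y m]
      by (simp only: of_nat_mult of_nat_power not_False_eq_True)
  qed
  then show ?thesis by (simp add: cong_0_iff)
qed

end
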